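(* Let $\alpha>0$ and for $x>0$ define $$\mu_\alpha^{\text{(a-s)}^2}(x)=\frac{\partial}{\partial\alpha}\left(\frac{1}{|\Gamma(\alpha)\,W_{-\alpha+1/2,0}(-x)|^2}\right)$$ (the limiting density of states, in squared variables, of the anti-symmetric Gaussian $\alpha$-ensemble). Then, as $x\to0^+$, $$\mu_\alpha^{\text{(a-s)}^2}(x)\sim\frac{2}{x}\,\frac{\psi'(\alpha)}{|\ln x|^3},\qquad \psi'(\alpha)=\sum_{n=0}^\infty\frac1{(\alpha+n)^2}.$$
   Context: $W_{\kappa,\mu}(z)$ is the standard Whittaker function; $W_{\kappa,\mu}(-x)$ for $x>0$ denotes a boundary value on the branch cut along the negative real axis, $-x\pm i0$ (for real parameters the modulus is the same for both choices). $\psi=\Gamma'/\Gamma$ is the digamma function and $\psi'$ the trigamma function. $f\sim g$ means $f/g\to1$. *)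

theory Defs
  imports "HOL-Complex_Analysis.Complex_Analysis" "HOL-Library.Landau_Symbols"
begin

definition kummer_M :: "complex \<Rightarrow> complex \<Rightarrow> complex \<Rightarrow> complex" where
  "kummer_M a b z = (\<Sum>n. pochhammer a n / (pochhammer b n * fact n) * z ^ n)"

(* Connection formula for the Kummer (Tricomi) function U(a,b,z) with non-integer b.
   The library's rGamma is the entire function 1/Gamma, which also covers the poles of Gamma. *)
definition tricomi_U_generic :: "complex \<Rightarrow> complex \<Rightarrow> complex \<Rightarrow> complex" where
  "tricomi_U_generic a b z =
     Gamma (1 - b) * rGamma (a - b + 1) * kummer_M a b z
     + Gamma (b - 1) * rGamma a * z powr (1 - b) * kummer_M (a - b + 1) (2 - b) z"

(* For integer b the connection formula has removable singularities (Abramowitz-Stegun 13.1.3,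
   DLMF 13.2.42); this is the case needed below, where b = 1. *)
definition tricomi_U :: "complex \<Rightarrow> complex \<Rightarrow> complex \<Rightarrow> complex" where
  "tricomi_U a b z =
     (if b \<in> \<int> then Lim (at b) (\<lambda>c. tricomi_U_generic a c z) else tricomi_U_generic a b z)"

(* Abramowitz-Stegun 13.1.33, DLMF 13.14.3; principal branch, cut along the negative real axis. *)
definition whittaker_W :: "complex \<Rightarrow> complex \<Rightarrow> complex \<Rightarrow> complex" where
  "whittaker_W \<kappa> \<mu> z =
     exp (- z / 2) * z powr (1 / 2 + \<mu>) * tricomi_U (1 / 2 + \<mu> - \<kappa>) (1 + 2 * \<mu>) z"

(* The boundary value at -x + i0 (for s = 1) or -x - i0 (for s = -1). *)
definition whittaker_W_cut :: "real \<Rightarrow> complex \<Rightarrow> complex \<Rightarrow> real \<Rightarrow> complex" where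
  "whittaker_W_cut s \<kappa> \<mu> x =
     Lim (at_right 0) (\<lambda>\<epsilon>::real. whittaker_W \<kappa> \<mu> (Complex (- x) (s * \<epsilon>)))"

definition antisym_sq_density :: "real \<Rightarrow> real \<Rightarrow> real \<Rightarrow> real" where
  "antisym_sq_density s \<alpha> x =
     deriv (\<lambda>a::real. 1 / (cmod (Gamma (complex_of_real a)
                              * whittaker_W_cut s (complex_of_real (- a + 1 / 2)) 0 x))\<^sup>2) \<alpha>"

end

(* With the logarithmic form of U(a,1,z) the boundary values of the Whittaker function satisfy
   |Gamma(a) W(-x)|^2 = x e^x F(x,a),  F = ((ln x + psi(a) + 2 gamma) M + R)^2 + (pi M)^2,
   where M and R are power series in x with M = 1 + O(x) and R = O(x), and the same orders persist
   for the a-derivatives: dM/da = O(x), dR/da = O(x).  So F ~ (ln x)^2 and dF/da ~ 2 psi'(a) ln x,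
   and the density is - (dF/da) / (x e^x F^2). *)

theory Submission
  imports Defs "HOL-Real_Asymp.Real_Asymp"
begin

section \<open>Coefficients of the Kummer series\<close>

text \<open>An asymptotic formula in x cannot be differentiated in a, so the derivative of
  \<open>cut_F\<close> is computed exactly at fixed x and only then x tends to 0. This forces
  termwise differentiation of both series in the parameter. In that derivative dM/da appears
  multiplied by ln x, next to psi'(a) M, so dM/da tending to 0 would not suffice; the rate O(x) is
  what makes ln x times dM/da vanish. The logarithmic form has to be derived:
  \<open>tricomi_U\<close> at b = 1 is a limit in which two poles cancel, and evaluating it needs
  derivatives of \<open>kummer_M\<close> along lines that move both of its parameters. All these
  derivatives reduce to \<open>psum a n\<close> = psi(a + n) - psi(a), the logarithmic derivative of
  \<open>pochhammer a n\<close>.\<close>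

definition psum :: "'a::real_normed_field \<Rightarrow> nat \<Rightarrow> 'a" where
  "psum a n = (\<Sum>j<n. 1 / (a + of_nat j))"

definition kcoef :: "real \<Rightarrow> nat \<Rightarrow> real" where
  "kcoef a n = pochhammer a n / (fact n)\<^sup>2"

lemma of_real_psum: "of_real (psum a n) = psum (of_real a) n"
  by (simp add: psum_def)

lemma psum_nonneg: "a > 0 \<Longrightarrow> psum a n \<ge> (0::real)"
  by (auto simp: psum_def intro!: sum_nonneg)

text \<open>The growth is at most linear in n. The crude power of 2 is chosen so that a product of
  two such weights is still at most a constant times \<open>4 ^ n\<close>.\<close>

lemma psum_le:
  assumes "a \<ge> \<delta>" "\<delta> > (0::real)"
  shows "psum a n \<le> (1 / \<delta>) * 2 ^ n"
proof -
  have "psum a n \<le> (\<Sum>j<n. 1 / \<delta>)"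
    unfolding psum_def using assms by (intro sum_mono divide_left_mono) auto
  also have "\<dots> = (1 / \<delta>) * real n" by simp
  also have "\<dots> \<le> (1 / \<delta>) * 2 ^ n"
    using assms of_nat_less_two_power[of n, where 'a = real] by (intro mult_left_mono) auto
  finally show ?thesis .
qed

lemma has_field_derivative_pochhammer_psum:
  fixes a :: "'a::real_normed_field"
  assumes "\<And>j. a + of_nat j \<noteq> 0"
  shows "((\<lambda>a. pochhammer a n) has_field_derivative pochhammer a n * psum a n) (at a)"
proof (induction n)
  case (Suc n)
  have "((\<lambda>a. pochhammer a n * (a + of_nat n)) has_field_derivative
          pochhammer a n * psum a n * (a + of_nat n) + pochhammer a n) (at a)"
    by (auto intro!: derivative_eq_intros Suc.IH)
  moreover have "pochhammer a n * psum a n * (a + of_nat n) + pochhammer a n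
                   = pochhammer a (Suc n) * psum a (Suc n)"
    using assms[of n] by (simp add: pochhammer_Suc psum_def field_simps)
  ultimately show ?case by (simp add: pochhammer_Suc)
qed (simp add: psum_def)

lemma has_field_derivative_psum:
  fixes a :: "'a::real_normed_field"
  assumes "\<And>j. a + of_nat j \<noteq> 0"
  shows "((\<lambda>a. psum a n) has_field_derivative - (\<Sum>j<n. 1 / (a + of_nat j)\<^sup>2)) (at a)"
proof -
  have "((\<lambda>a. psum a n) has_field_derivative (\<Sum>j<n. - (1 / (a + of_nat j)\<^sup>2))) (at a)"
    unfolding psum_def using assms
    by (intro DERIV_sum) (auto intro!: derivative_eq_intros simp: power2_eq_square)
  then show ?thesis by (simp add: sum_negf)
qed

section \<open>Majorants and termwise differentiation in the parameter\<close>

lemma norm_pochhammer_le: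
  fixes a :: "'a::real_normed_field"
  assumes "norm a \<le> A"
  shows "norm (pochhammer a n) \<le> pochhammer A n"
proof -
  have "norm (a + of_nat i) \<le> A + real i" for i
    using norm_triangle_ineq[of a "of_nat i"] assms by simp
  then show ?thesis
    by (auto simp: pochhammer_prod prod_norm[symmetric] intro!: prod_mono)
qed

lemma norm_pochhammer_ge:
  assumes "Re b \<ge> B" "B > 0"
  shows "pochhammer B n \<le> norm (pochhammer b n)"
proof -
  have "B + real i \<le> norm (b + of_nat i)" for i
    using complex_Re_le_cmod[of "b + of_nat i"] assms by simp
  then show ?thesis using assms
    by (auto simp: pochhammer_prod prod_norm[symmetric] intro!: prod_mono)
qed

text \<open>The ratio of consecutive terms tends to 0. The case B = 1 serves \<open>kcoef\<close>,
  because \<open>pochhammer 1 n\<close> is \<open>fact n\<close>; B = 1/2 serves a second parameter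
  that varies near 1.\<close>

lemma summable_kummer_majorant:
  fixes A B X :: real
  assumes "A > 0" "B > 0" "X \<ge> 0"
  shows "summable (\<lambda>n. pochhammer A n / (pochhammer B n * fact n) * X ^ n)"
proof -
  have "((\<lambda>n. (A + real n) / ((B + real n) * (1 + real n)) * X) \<longlongrightarrow> 0) at_top"
  proof -
    have "((\<lambda>n. (A + real n) / ((B + real n) * (1 + real n))) \<longlongrightarrow> 0) at_top"
      by real_asymp
    from tendsto_mult_left_zero[OF this, of X] show ?thesis .
  qed
  then have "eventually (\<lambda>n. (A + real n) / ((B + real n) * (1 + real n)) * X < 1/2) at_top"
    by (rule order_tendstoD) simp
  then obtain N where N: "\<And>n. n \<ge> N \<Longrightarrow> (A + real n) / ((B + real n) * (1 + real n)) * X < 1/2"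
    by (auto simp: eventually_at_top_linorder)
  show ?thesis
  proof (rule summable_ratio_test[of "1/2" N])
    fix n assume n: "n \<ge> N"
    define t where "t = pochhammer A n / (pochhammer B n * fact n) * X ^ n"
    have t: "t \<ge> 0" unfolding t_def using assms
      by (intro mult_nonneg_nonneg divide_nonneg_nonneg pochhammer_nonneg) auto
    define r where "r = (A + real n) / ((B + real n) * (1 + real n)) * X"
    have step: "pochhammer A (Suc n) / (pochhammer B (Suc n) * fact (Suc n)) * X ^ Suc n = r * t"
      by (simp add: t_def r_def pochhammer_Suc mult_ac)
    have "0 \<le> r" unfolding r_def using assms by simp
    moreover have "r * t \<le> 1/2 * t"
      using N[OF n] t unfolding r_def[symmetric] by (intro mult_right_mono) auto
    ultimately show "norm (pochhammer A (Suc n) / (pochhammer B (Suc n) * fact (Suc n)) * X ^ Suc n)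
        \<le> 1/2 * norm (pochhammer A n / (pochhammer B n * fact n) * X ^ n)"
      using t unfolding step t_def[symmetric] by simp
  qed simp
qed

lemma kcoef_nonneg: "a > 0 \<Longrightarrow> kcoef a n \<ge> 0"
  by (simp add: kcoef_def pochhammer_nonneg)

lemma kcoef_mono: "0 < a \<Longrightarrow> a \<le> A \<Longrightarrow> kcoef a n \<le> kcoef A n"
  using norm_pochhammer_le[of a A n]
  by (auto simp: kcoef_def pochhammer_nonneg intro!: divide_right_mono)

text \<open>A geometric weight costs nothing for an entire series: \<open>4 ^ n\<close> is absorbed
  by evaluating at 4 X.\<close>

lemma summable_kcoef_majorant:
  assumes "a > 0" "X \<ge> 0"
  shows "summable (\<lambda>n. kcoef a n * (C * 4 ^ n) * X ^ n)"
proof -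
  have "summable (\<lambda>n. C * (pochhammer a n / (pochhammer 1 n * fact n) * (4 * X) ^ n))"
    by (intro summable_mult summable_kummer_majorant) (use assms in auto)
  then show ?thesis
    by (simp add: kcoef_def pochhammer_fact[symmetric] power2_eq_square power_mult_distrib mult_ac)
qed

lemma summable_kcoef:
  assumes "a > 0" "\<And>n. \<bar>c n\<bar> \<le> C * 4 ^ n"
  shows "summable (\<lambda>n. of_real (kcoef a n * c n) * (y::'a::{real_normed_field,banach}) ^ n)"
proof (rule summable_comparison_test'[OF summable_kcoef_majorant[OF assms(1), of "norm y" C]])
  fix n
  have "norm (of_real (kcoef a n * c n) * y ^ n) = kcoef a n * \<bar>c n\<bar> * norm y ^ n"
    using kcoef_nonneg[OF assms(1), of n]
    by (simp add: norm_mult norm_power abs_mult)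
  also have "\<dots> \<le> kcoef a n * (C * 4 ^ n) * norm y ^ n"
    using kcoef_nonneg[OF assms(1), of n] assms(2)[of n] by (intro mult_mono) auto
  finally show "norm (of_real (kcoef a n * c n) * y ^ n) \<le> kcoef a n * (C * 4 ^ n) * norm y ^ n" .
qed simp

text \<open>The logarithmic derivative of \<open>kcoef b n\<close> in b is \<open>psum b n\<close>,
  so the product rule gives the new weight. Convergence is uniform for b in (a/2, a + 1): there
  \<open>kcoef b n\<close> is at most \<open>kcoef (a+1) n\<close>, and the lower end keeps b away
  from the pole of \<open>psum\<close> at 0.\<close>

lemma has_real_derivative_kcoef_series:
  fixes w w' :: "real \<Rightarrow> nat \<Rightarrow> real"
  assumes "a > 0"
    and w: "\<And>n b. b > 0 \<Longrightarrow> ((\<lambda>b. w b n) has_real_derivative w' b n) (at b)"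
    and bd: "\<And>n b. b \<ge> a / 2 \<Longrightarrow> \<bar>w b n\<bar> \<le> C * 4 ^ n"
    and bd': "\<And>n b. b \<ge> a / 2 \<Longrightarrow> \<bar>psum b n * w b n + w' b n\<bar> \<le> C * 4 ^ n"
  shows "((\<lambda>b. \<Sum>n. kcoef b n * w b n * y ^ n) has_real_derivative
           (\<Sum>n. kcoef a n * (psum a n * w a n + w' a n) * y ^ n)) (at a)"
proof (rule has_field_derivative_series'(2))
  let ?S = "{a/2<..<a+1}"
  show "convex ?S" by simp
  show "a \<in> ?S" "a \<in> interior ?S" using assms(1) by auto
  show "summable (\<lambda>n. kcoef a n * w a n * y ^ n)"
    using summable_kcoef[of a "w a" C y] bd[of a] assms(1) by simp
  fix n b assume b: "b \<in> ?S"
  then have "b > 0" using assms(1) by simp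
  then have "b + real j \<noteq> 0" for j by (simp add: add_pos_nonneg less_imp_neq[symmetric])
  then have "((\<lambda>b. kcoef b n) has_real_derivative kcoef b n * psum b n) (at b)"
    unfolding kcoef_def
    by (auto intro!: derivative_eq_intros has_field_derivative_pochhammer_psum simp: field_simps)
  from DERIV_mult[OF this w[OF \<open>b > 0\<close>, of n]]
  have "((\<lambda>b. kcoef b n * w b n) has_real_derivative
           kcoef b n * (psum b n * w b n + w' b n)) (at b)"
    by (simp add: algebra_simps)
  from DERIV_cmult_right[OF this, of "y ^ n"]
  show "((\<lambda>b. kcoef b n * w b n * y ^ n) has_real_derivative
           kcoef b n * (psum b n * w b n + w' b n) * y ^ n) (at b within ?S)"
    by (rule has_field_derivative_at_within)
next
  show "uniformly_convergent_on {a/2<..<a+1}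
          (\<lambda>n b. \<Sum>i<n. kcoef b i * (psum b i * w b i + w' b i) * y ^ i)"
  proof (rule Weierstrass_m_test')
    show "summable (\<lambda>n. kcoef (a+1) n * (C * 4 ^ n) * \<bar>y\<bar> ^ n)"
      using assms(1) by (intro summable_kcoef_majorant) auto
    fix n b assume "b \<in> {a/2<..<a+1}"
    then have b: "b > 0" "b \<le> a+1" "b \<ge> a/2" using assms(1) by auto
    show "norm (kcoef b n * (psum b n * w b n + w' b n) * y ^ n)
            \<le> kcoef (a+1) n * (C * 4 ^ n) * \<bar>y\<bar> ^ n"
      unfolding real_norm_def abs_mult power_abs
      using kcoef_nonneg[OF b(1), of n] kcoef_mono[OF b(1,2), of n] bd'[OF b(3), of n]
      by (intro mult_mono) auto
  qed
qed

section \<open>The regular and the logarithmic series, and their parameter derivatives\<close>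

definition kser :: "real \<Rightarrow> 'a::{real_normed_field,banach} \<Rightarrow> 'a" where
  "kser a z = (\<Sum>n. of_real (kcoef a n) * z ^ n)"

text \<open>The weight \<open>psum a n - 2 * psum 1 n\<close> is \<open>\<psi>(a + n) - \<psi>(a) - 2 (\<psi>(1 + n) - \<psi>(1))\<close>.\<close>

definition kser_log :: "real \<Rightarrow> 'a::{real_normed_field,banach} \<Rightarrow> 'a" where
  "kser_log a z = (\<Sum>n. of_real (kcoef a n * (psum a n - 2 * psum 1 n)) * z ^ n)"

lemma mult_power_two_le_four: "c * 2 ^ n \<le> c * (4::real) ^ n" if "c \<ge> 0"
  using that by (intro mult_left_mono power_mono) auto

lemma abs_psum_le4:
  assumes "a \<ge> \<delta>" "\<delta> > (0::real)"
  shows "\<bar>psum a n\<bar> \<le> (1 / \<delta>) * 4 ^ n"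
  using psum_le[OF assms, of n] psum_nonneg[of a n] mult_power_two_le_four[of "1/\<delta>" n] assms
  by auto

lemma abs_log_weight_le:
  assumes "a \<ge> \<delta>" "\<delta> > (0::real)"
  shows "\<bar>psum a n - 2 * psum 1 n\<bar> \<le> (1 / \<delta> + 2) * 2 ^ n"
  using psum_le[OF assms, of n] psum_nonneg[of a n] psum_nonneg[of 1 n] psum_le[of 1 1 n] assms
  by (auto simp: algebra_simps abs_le_iff)

lemma abs_log_weight_le4:
  assumes "a \<ge> \<delta>" "\<delta> > (0::real)"
  shows "\<bar>psum a n - 2 * psum 1 n\<bar> \<le> (1 / \<delta> + 2) * 4 ^ n"
  using abs_log_weight_le[OF assms, of n] mult_power_two_le_four[of "1/\<delta> + 2" n] assms by auto

text \<open>The series are polymorphic because the boundary limit needs complex arguments, while the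
  derivative in a is taken over the reals. This lemma and the next pass between the two.\<close>

lemma kser_of_real:
  assumes "a > 0"
  shows "kser a (of_real x :: complex) = of_real (kser a x)"
  using suminf_of_real[OF summable_kcoef[of a "\<lambda>_. 1" 1 x, OF assms], where 'a = complex]
  by (simp add: kser_def)

lemma kser_log_of_real:
  assumes "a > 0"
  shows "kser_log a (of_real x :: complex) = of_real (kser_log a x)"
  using suminf_of_real[OF summable_kcoef[of a "\<lambda>n. psum a n - 2 * psum 1 n" _ x, OF assms
      abs_log_weight_le4[OF order_refl assms]], where 'a = complex]
  by (simp add: kser_log_def)

lemma isCont_kser:
  assumes "a > 0"
  shows "isCont (kser a :: 'a::{real_normed_field,banach} \<Rightarrow> 'a) z"
  unfolding kser_def
  using summable_kcoef[of a "\<lambda>_. 1" 1, where 'a = 'a, OF assms]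
  by (intro isCont_powser_converges_everywhere) simp

lemma isCont_kser_log:
  assumes "a > 0"
  shows "isCont (kser_log a :: 'a::{real_normed_field,banach} \<Rightarrow> 'a) z"
  unfolding kser_log_def
  by (rule isCont_powser_converges_everywhere)
     (rule summable_kcoef[OF assms abs_log_weight_le4[OF order_refl assms]])

lemma kser_0: "kser a 0 = (1 :: 'a::{real_normed_field,banach})"
  using powser_zero[of "\<lambda>n. of_real (kcoef a n) :: 'a"] by (simp add: kser_def kcoef_def)

lemma kser_log_0: "kser_log a 0 = (0 :: 'a::{real_normed_field,banach})"
  using powser_zero[of "\<lambda>n. of_real (kcoef a n * (psum a n - 2 * psum 1 n)) :: 'a"]
  by (simp add: kser_log_def kcoef_def psum_def)

lemma power_series_at_0:
  fixes c :: "nat \<Rightarrow> real"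
  assumes "\<And>y. summable (\<lambda>n. c n * y ^ n)" "c 0 = 0"
  obtains D where "((\<lambda>x. \<Sum>n. c n * x ^ n) has_real_derivative D) (at 0)" "(\<Sum>n. c n * 0 ^ n) = 0"
  using termdiffs_strong_converges_everywhere[OF assms(1), of 0] assms(2) by (auto simp: powser_zero)

text \<open>A power series without constant term is O(y). This is recorded as k' 0 = 0 together with
  differentiability of k' at 0, which is the form that later beats the factor ln x.\<close>

lemma kser_has_derivative_param:
  assumes "a > 0"
  obtains k' D where "\<And>y. ((\<lambda>b. kser b y) has_real_derivative k' y) (at a)"
    "(k' has_real_derivative D) (at 0)" "k' 0 = 0"
proof -
  let ?c = "\<lambda>n. kcoef a n * psum a n"
  let ?C = "1 + 2 / a"
  have C: "\<bar>psum b n\<bar> \<le> ?C * 4 ^ n" if "b \<ge> a/2" for b n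
    using abs_psum_le4[of "a/2" b n] assms that by (simp add: algebra_simps add_increasing)
  have *: "((\<lambda>b. kser b y) has_real_derivative (\<Sum>n. ?c n * y ^ n)) (at a)" for y
    using has_real_derivative_kcoef_series[of a "\<lambda>_ _. 1" "\<lambda>_ _. 0" ?C y] C assms
    by (simp add: kser_def algebra_simps add_increasing2 one_le_power)
  have "summable (\<lambda>n. ?c n * y ^ n)" for y
    using summable_kcoef[of a "psum a" ?C y] C assms by simp
  then obtain D where "((\<lambda>x. \<Sum>n. ?c n * x ^ n) has_real_derivative D) (at 0)"
      "(\<Sum>n. ?c n * 0 ^ n) = 0"
    by (rule power_series_at_0) (auto simp: psum_def)
  with * show ?thesis by (rule that)
qed

lemma kser_log_has_derivative_param:
  assumes "a > 0"
  obtains k' D where "\<And>y. ((\<lambda>b. kser_log b y) has_real_derivative k' y) (at a)"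
    "(k' has_real_derivative D) (at 0)" "k' 0 = 0"
proof -
  define w where "w = (\<lambda>b n. psum b n - 2 * psum 1 n :: real)"
  define w' where "w' = (\<lambda>b n. - (\<Sum>j<n. 1 / (b + real j)\<^sup>2))"
  define v where "v = (\<lambda>b n. psum b n * w b n + w' b n)"
  let ?c = "\<lambda>n. kcoef a n * v a n"
  define \<delta> where "\<delta> = a / 2"
  have \<delta>: "\<delta> > 0" using assms by (simp add: \<delta>_def)
  \<comment> \<open>The sum of the bounds for w, for the product of \<open>psum\<close> with w, and
    for w', so that one constant serves both w and v.\<close>
  define C where "C = (1 / \<delta> + 2) + (1 / \<delta>) * (1 / \<delta> + 2) + 1 / \<delta>\<^sup>2"
  have w: "\<bar>w b n\<bar> \<le> C * 4 ^ n" if "b \<ge> a/2" for b n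
  proof -
    have "\<bar>w b n\<bar> \<le> (1 / \<delta> + 2) * 4 ^ n"
      unfolding w_def using abs_log_weight_le4[of \<delta> b n] \<delta> that by (simp add: \<delta>_def)
    also have "\<dots> \<le> C * 4 ^ n" unfolding C_def using \<delta> by (intro mult_right_mono) auto
    finally show ?thesis .
  qed
  have v: "\<bar>v b n\<bar> \<le> C * 4 ^ n" if "b \<ge> a/2" for b n
  proof -
    have b: "b \<ge> \<delta>" "b > 0" using that \<delta> by (auto simp: \<delta>_def)
    have "\<bar>psum b n * w b n\<bar> \<le> ((1 / \<delta>) * 2 ^ n) * ((1 / \<delta> + 2) * 2 ^ n)"
      unfolding abs_mult w_def
      using abs_log_weight_le[of \<delta> b n] psum_le[of \<delta> b n] psum_nonneg[of b n] b \<delta>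
      by (intro mult_mono) auto
    also have "\<dots> = (1 / \<delta>) * (1 / \<delta> + 2) * 4 ^ n"
      by (simp add: power_mult_distrib[symmetric])
    finally have 1: "\<bar>psum b n * w b n\<bar> \<le> (1 / \<delta>) * (1 / \<delta> + 2) * 4 ^ n" .
    have "\<bar>w' b n\<bar> = (\<Sum>j<n. 1 / (b + real j)\<^sup>2)"
      unfolding w'_def abs_minus_cancel by (intro abs_of_nonneg sum_nonneg) auto
    also have "\<dots> \<le> (\<Sum>j<n. 1 / \<delta>\<^sup>2)"
      using b \<delta> by (intro sum_mono divide_left_mono power_mono) auto
    also have "\<dots> = 1 / \<delta>\<^sup>2 * real n" by simp
    also have "\<dots> \<le> 1 / \<delta>\<^sup>2 * 4 ^ n"
    proof (rule mult_left_mono)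
      show "real n \<le> 4 ^ n"
        using of_nat_less_two_power[of n, where 'a = real] mult_power_two_le_four[of 1 n] by simp
    qed simp
    finally have 2: "\<bar>w' b n\<bar> \<le> 1 / \<delta>\<^sup>2 * 4 ^ n" .
    have "\<bar>v b n\<bar> \<le> (1 / \<delta>) * (1 / \<delta> + 2) * 4 ^ n + 1 / \<delta>\<^sup>2 * 4 ^ n"
      unfolding v_def using 1 2 by linarith
    also have "\<dots> = ((1 / \<delta>) * (1 / \<delta> + 2) + 1 / \<delta>\<^sup>2) * 4 ^ n" by (simp add: algebra_simps)
    also have "\<dots> \<le> C * 4 ^ n" unfolding C_def using \<delta> by (intro mult_right_mono) auto
    finally show ?thesis .
  qed
  have dw: "((\<lambda>b. w b n) has_real_derivative w' b n) (at b)" if "b > 0" for b n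
  proof -
    have "b + real j \<noteq> 0" for j using that by (simp add: add_pos_nonneg less_imp_neq[symmetric])
    then show ?thesis unfolding w_def w'_def
      by (auto intro!: derivative_eq_intros has_field_derivative_psum)
  qed
  have *: "((\<lambda>b. kser_log b y) has_real_derivative (\<Sum>n. ?c n * y ^ n)) (at a)" for y
    using has_real_derivative_kcoef_series[of a w w' C y, OF assms dw w] v
    by (simp add: kser_log_def w_def v_def)
  have "summable (\<lambda>n. ?c n * y ^ n)" for y
    using summable_kcoef[of a "v a" C y] v assms by simp
  then obtain D where "((\<lambda>x. \<Sum>n. ?c n * x ^ n) has_real_derivative D) (at 0)"
      "(\<Sum>n. ?c n * 0 ^ n) = 0"
    by (rule power_series_at_0) (auto simp: v_def w'_def psum_def)
  with * show ?thesis by (rule that)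
qed

section \<open>The logarithmic case of the Tricomi function\<close>

text \<open>The connection formula at second parameter c involves the pairs (a, c) and (a - c + 1, 2
  - c), that is (p, q) = (0, 1) and (-1, -1). Termwise differentiation in c is justified by a
  majorant that does not depend on c.\<close>

lemma kummer_M_has_derivative_param:
  fixes a p q :: real and z :: complex
  assumes a: "a > 0" and p: "\<bar>p\<bar> \<le> 1" and q: "\<bar>q\<bar> \<le> 1"
  shows "((\<lambda>c. kummer_M (of_real a + of_real p * (c - 1)) (1 + of_real q * (c - 1)) z)
           has_field_derivative
           (\<Sum>n. of_real (kcoef a n * (p * psum a n - q * psum 1 n)) * z ^ n)) (at 1)"
proof -
  \<comment> \<open>With this radius the first parameter keeps positive real part and the second has
    real part at least 1/2, so no Pochhammer symbol vanishes and \<open>psum\<close> has no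
    pole.\<close>
  define \<rho> where "\<rho> = min a 1 / 2"
  define S where "S = ball (1::complex) \<rho>"
  define A where "A = (\<lambda>c::complex. of_real a + of_real p * (c - 1) :: complex)"
  define B where "B = (\<lambda>c::complex. 1 + of_real q * (c - 1) :: complex)"
  define f where "f = (\<lambda>n c. pochhammer (A c) n / (pochhammer (B c) n * fact n) * z ^ n)"
  define f' where "f' = (\<lambda>n c. f n c * (of_real p * psum (A c) n - of_real q * psum (B c) n))"
  have \<rho>: "\<rho> > 0" "\<rho> \<le> a/2" "\<rho> \<le> 1/2" using a by (auto simp: \<rho>_def)
  have small: "norm (of_real r * (c - 1)) \<le> \<rho>" if "c \<in> S" "\<bar>r\<bar> \<le> 1" for c r
  proof -
    have "\<bar>r\<bar> * norm (c - 1) \<le> 1 * \<rho>"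
      using that by (intro mult_mono) (auto simp: S_def dist_norm norm_minus_commute)
    then show ?thesis by (simp add: norm_mult)
  qed
  have ReA: "Re (A c) > 0" and ReB: "Re (B c) \<ge> 1/2" and nA: "norm (A c) \<le> a + 1"
    if "c \<in> S" for c
  proof -
    show "Re (A c) > 0"
      using abs_Re_le_cmod[of "of_real p * (c - 1)"] small[OF that p] \<rho> a
      unfolding A_def plus_complex.sel Re_complex_of_real by linarith
    show "Re (B c) \<ge> 1/2"
      using abs_Re_le_cmod[of "of_real q * (c - 1)"] small[OF that q] \<rho>
      unfolding B_def plus_complex.sel one_complex.sel by linarith
    show "norm (A c) \<le> a + 1"
      using norm_triangle_ineq[of "of_real a" "of_real p * (c - 1)"] small[OF that p] \<rho> a
      unfolding A_def by simp
  qed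
  have nz: "w + of_nat j \<noteq> 0" if "Re w > 0" for w :: complex and j
    using that by (auto simp: complex_eq_iff)
  have "\<exists>g g'. \<forall>c\<in>S. (\<lambda>n. f n c) sums g c \<and> (\<lambda>n. f' n c) sums g' c \<and>
          (g has_field_derivative g' c) (at c)"
  proof (rule series_and_derivative_comparison_complex)
    show "open S" by (simp add: S_def)
    fix n c assume c: "c \<in> S"
    have A': "\<And>j. A c + of_nat j \<noteq> 0" and B': "\<And>j. B c + of_nat j \<noteq> 0"
      using nz ReA[OF c] ReB[OF c] by auto
    have B0: "pochhammer (B c) n \<noteq> 0"
      using B' by (auto simp: pochhammer_prod)
    have dA: "((\<lambda>c. pochhammer (A c) n) has_field_derivative
               pochhammer (A c) n * psum (A c) n * of_real p) (at c)"
      by (rule DERIV_chain2[where f = "\<lambda>a. pochhammer a n" and g = A])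
         (auto intro!: has_field_derivative_pochhammer_psum A', auto simp: A_def intro!: derivative_eq_intros)
    have dB: "((\<lambda>c. pochhammer (B c) n) has_field_derivative
               pochhammer (B c) n * psum (B c) n * of_real q) (at c)"
      by (rule DERIV_chain2[where f = "\<lambda>a. pochhammer a n" and g = B])
         (auto intro!: has_field_derivative_pochhammer_psum B', auto simp: B_def intro!: derivative_eq_intros)
    show "(f n has_field_derivative f' n c) (at c)"
      unfolding f_def
      by (rule DERIV_cong[OF DERIV_cmult_right[OF DERIV_divide[OF dA DERIV_cmult_right[OF dB]]]])
         (use B0 in \<open>simp_all add: f'_def f_def divide_simps, simp_all add: algebra_simps\<close>)
  next
    fix c assume "c \<in> S"
    \<comment> \<open>The numerator is bounded through norm (A c) at most a + 1, the denominator
      through Re (B c) at least 1/2.\<close>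
    define h where "h = (\<lambda>n. pochhammer (a + 1) n / (pochhammer (1/2) n * fact n) * norm z ^ n)"
    have h: "summable h" unfolding h_def
      using a by (intro summable_kummer_majorant) auto
    have h0: "h n \<ge> 0" for n unfolding h_def using a
      by (intro mult_nonneg_nonneg divide_nonneg_nonneg pochhammer_nonneg) auto
    have le: "norm (f n y) \<le> norm (of_real (h n) :: complex)" if "y \<in> S" for n y
    proof -
      have "norm (f n y) = norm (pochhammer (A y) n) / (norm (pochhammer (B y) n) * fact n) * norm z ^ n"
        by (simp add: f_def norm_mult norm_divide norm_power)
      also have "\<dots> \<le> h n"
        unfolding h_def
        using norm_pochhammer_le[OF nA[OF that], of n] norm_pochhammer_ge[OF ReB[OF that], of n]
          pochhammer_pos[of "1/2::real" n] a
        by (intro mult_right_mono frac_le mult_right_mono mult_pos_pos) (auto intro: pochhammer_nonneg)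
      finally show ?thesis using h0[of n] by simp
    qed
    show "\<exists>d h. 0 < d \<and> summable h \<and> range h \<subseteq> \<real>\<^sub>\<ge>\<^sub>0 \<and>
            (\<forall>\<^sub>F n in sequentially. \<forall>y\<in>ball c d \<inter> S. cmod (f n y) \<le> cmod (h n))"
      by (rule exI[of _ 1], rule exI[of _ "\<lambda>n. of_real (h n)"])
         (use h h0 le in \<open>auto simp: summable_of_real\<close>)
  qed
  then obtain g g' where g: "\<And>c. c \<in> S \<Longrightarrow> (\<lambda>n. f n c) sums g c"
      "\<And>c. c \<in> S \<Longrightarrow> (\<lambda>n. f' n c) sums g' c"
      "\<And>c. c \<in> S \<Longrightarrow> (g has_field_derivative g' c) (at c)"
    by blast
  have 1: "1 \<in> S" using \<rho> by (simp add: S_def)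
  have "f' n 1 = of_real (kcoef a n * (p * psum a n - q * psum 1 n)) * z ^ n" for n
    by (simp add: f'_def f_def A_def B_def kcoef_def of_real_psum pochhammer_of_real
        pochhammer_fact[symmetric] power2_eq_square)
  then have "g' 1 = (\<Sum>n. of_real (kcoef a n * (p * psum a n - q * psum 1 n)) * z ^ n)"
    using g(2)[OF 1] by (simp add: sums_iff)
  moreover have "g c = kummer_M (A c) (B c) z" if "c \<in> S" for c
    using g(1)[OF that] by (simp add: f_def kummer_M_def sums_iff)
  moreover have "open S" by (simp add: S_def)
  ultimately show ?thesis
    using has_field_derivative_transform_within_open[OF g(3)[OF 1] _ 1]
    unfolding A_def B_def by simp
qed

lemma kummer_M_kser: "kummer_M (of_real a) 1 z = kser a z"
  by (simp add: kummer_M_def kser_def kcoef_def pochhammer_fact[symmetric] pochhammer_of_real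
      power2_eq_square)

lemma complex_of_real_pos_notin_nonpos_Ints: "a > 0 \<Longrightarrow> complex_of_real a \<notin> \<int>\<^sub>\<le>\<^sub>0"
  by (auto elim!: nonpos_Ints_cases simp: complex_eq_iff)

text \<open>Writing \<open>\<Gamma>(1 - c)\<close> and \<open>\<Gamma>(c - 1)\<close> as multiples of \<open>1 / (c - 1)\<close> turns the connection formula
  into a difference quotient at \<open>c = 1\<close>.\<close>

lemma tricomi_U_log:
  fixes a :: real and z :: complex
  assumes a: "a > 0" and z: "z \<noteq> 0"
  shows "tricomi_U (of_real a) 1 z =
    - rGamma (of_real a) * ((Ln z + Digamma (of_real a) + 2 * euler_mascheroni) * kser a z + kser_log a z)"
    (is "_ = ?R")
proof -
  let ?a = "complex_of_real a"
  note aZ = complex_of_real_pos_notin_nonpos_Ints[OF a]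
  define M1 where "M1 = (\<lambda>c. kummer_M (?a - c + 1) (2 - c) z)"
  define M2 where "M2 = (\<lambda>c. kummer_M ?a c z)"
  define D1 where "D1 = (\<Sum>n. of_real (kcoef a n * (psum 1 n - psum a n)) * z ^ n)"
  define D2 where "D2 = (\<Sum>n. of_real (kcoef a n * (- psum 1 n)) * z ^ n)"
  \<comment> \<open>This is c - 1 times the connection formula: \<open>Gamma c\<close> is (c - 1)
    Gamma(c - 1), and \<open>Gamma (2 - c)\<close> is (1 - c) Gamma(1 - c), which accounts for the
    minus sign.\<close>
  define N where "N = (\<lambda>c. Gamma c * rGamma ?a * z powr (1 - c) * M1 c
                           - Gamma (2 - c) * rGamma (?a - c + 1) * M2 c)"
  have M1: "(M1 has_field_derivative D1) (at 1)"
    using kummer_M_has_derivative_param[OF a, of "-1" "-1" z]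
    by (simp add: M1_def D1_def algebra_simps)
  have M2: "(M2 has_field_derivative D2) (at 1)"
    using kummer_M_has_derivative_param[OF a, of 0 1 z] by (simp add: M2_def D2_def)
  have M1v: "M1 1 = kser a z" and M2v: "M2 1 = kser a z"
    by (simp_all add: M1_def M2_def kummer_M_kser)
  have 1: "(1::complex) \<notin> \<int>\<^sub>\<le>\<^sub>0" by simp
  have dG: "(Gamma has_field_derivative - euler_mascheroni) (at (1::complex))"
    using has_field_derivative_Gamma[OF 1, of UNIV] by simp
  have dG2: "((\<lambda>c. Gamma (2 - c)) has_field_derivative euler_mascheroni) (at (1::complex))"
    using DERIV_chain2[of Gamma "- euler_mascheroni" "\<lambda>c. 2 - c" 1 "-1" UNIV] dG
    by (auto intro!: derivative_eq_intros)
  have dr: "((\<lambda>c. rGamma (?a - c + 1)) has_field_derivative rGamma ?a * Digamma ?a) (at 1)"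
  proof -
    have "((\<lambda>c. rGamma (?a - c + 1)) has_field_derivative (- rGamma ?a * Digamma ?a) * (-1)) (at 1)"
      by (rule DERIV_chain2[of rGamma])
         (use has_field_derivative_rGamma_no_nonpos_int[OF aZ, of UNIV] in
           \<open>auto intro!: derivative_eq_intros\<close>)
    then show ?thesis by simp
  qed
  have dz: "((\<lambda>c. z powr (1 - c)) has_field_derivative - Ln z) (at 1)"
    using z unfolding powr_def by (auto intro!: derivative_eq_intros)
  have "(N has_field_derivative
      ((- euler_mascheroni) * rGamma ?a * kser a z - rGamma ?a * Ln z * kser a z + rGamma ?a * D1
        - (euler_mascheroni * rGamma ?a * kser a z + rGamma ?a * Digamma ?a * kser a z
            + rGamma ?a * D2))) (at 1)"
    unfolding N_def
    by (rule DERIV_cong[OF DERIV_diff[OF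
          DERIV_mult[OF DERIV_mult[OF DERIV_cmult_right[OF dG] dz] M1]
          DERIV_mult[OF DERIV_mult[OF dG2 dr] M2]]])
       (use z in \<open>simp add: M1v M2v algebra_simps\<close>)
  \<comment> \<open>The weight of D1 - D2 is 2 \<open>psum 1 n\<close> - \<open>psum a n\<close>,
    the negative of the weight of \<open>kser_log\<close>.\<close>
  moreover have D1: "D1 = D2 - kser_log a z"
  proof -
    have s1: "summable (\<lambda>n. of_real (kcoef a n * (psum 1 n - psum a n)) * z ^ n)"
    proof (rule summable_kcoef[OF a])
      fix n show "\<bar>psum 1 n - psum a n\<bar> \<le> (1 + 1 / a) * 4 ^ n"
        using abs_psum_le4[of a a n] abs_psum_le4[of 1 1 n] a by (simp add: algebra_simps)
    qed
    have s2: "summable (\<lambda>n. of_real (kcoef a n * (- psum 1 n)) * z ^ n)"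
      by (rule summable_kcoef[OF a, of _ 1]) (use abs_psum_le4[of 1 1] in simp)
    have "D1 - D2 = (\<Sum>n. - (of_real (kcoef a n * (psum a n - 2 * psum 1 n)) * z ^ n))"
      unfolding D1_def D2_def suminf_diff[OF s1 s2] by (simp add: algebra_simps)
    also have "\<dots> = - kser_log a z"
      unfolding kser_log_def
      by (intro suminf_minus summable_kcoef[OF a abs_log_weight_le4[OF order_refl a]])
    finally show ?thesis by (simp add: algebra_simps)
  qed
  ultimately have "(N has_field_derivative ?R) (at 1)"
    unfolding D1 by (elim DERIV_cong) (simp add: algebra_simps)
  then have lim: "((\<lambda>c. (N c - N 1) / (c - 1)) \<longlongrightarrow> ?R) (at 1)"
    by (simp add: has_field_derivative_iff)
  have "eventually (\<lambda>c. (N c - N 1) / (c - 1) = tricomi_U_generic ?a c z) (at 1)"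
  proof -
    have "eventually (\<lambda>c. c \<in> ball (1::complex) 1) (at 1)"
      by (rule eventually_at_in_open') auto
    moreover have "eventually (\<lambda>c. c \<noteq> (1::complex)) (at 1)"
      by (auto simp: eventually_at_filter)
    ultimately show ?thesis
    proof eventually_elim
      case (elim c)
      have nn: "w \<notin> \<int>\<^sub>\<le>\<^sub>0" if "norm w < 1" "w \<noteq> 0" for w :: complex
        using that by (auto elim!: nonpos_Ints_cases)
      have G1: "Gamma c = (c - 1) * Gamma (c - 1)"
        using Gamma_plus1[of "c - 1"] nn[of "c - 1"] elim by (simp add: dist_norm norm_minus_commute)
      have G2: "Gamma (2 - c) = (1 - c) * Gamma (1 - c)"
        using Gamma_plus1[of "1 - c"] nn[of "1 - c"] elim by (simp add: dist_norm)
      \<comment> \<open>At c = 1 both products equal \<open>rGamma\<close> of a times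
        \<open>kser a z\<close>; this is the cancellation of the poles.\<close>
      have "N 1 = 0" using z by (simp add: N_def M1v M2v)
      then show ?case using elim
        unfolding N_def tricomi_U_generic_def G1 G2 M1_def M2_def by (simp add: field_simps)
    qed
  qed
  from Lim_transform_eventually[OF lim this]
  have "Lim (at 1) (\<lambda>c. tricomi_U_generic ?a c z) = ?R"
    by (intro tendsto_Lim) auto
  then show ?thesis by (simp add: tricomi_U_def)
qed

section \<open>Boundary values on the branch cut\<close>

lemma tendsto_Ln_neg_cut:
  assumes x: "x > 0" and s: "s = 1 \<or> s = -1"
  shows "((\<lambda>\<epsilon>. Ln (Complex (- x) (s * \<epsilon>))) \<longlongrightarrow> Complex (ln x) (s * pi)) (at_right 0)"
proof -
  \<comment> \<open>\<open>Ln\<close> jumps at -x, so the limit is taken at the reflected point near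
    x, where \<open>Ln\<close> is continuous; the reflection shifts the logarithm by s i pi.\<close>
  have "((\<lambda>\<epsilon>. Ln (Complex x (- s * \<epsilon>)) + \<i> * of_real (s * pi)) \<longlongrightarrow> Ln (Complex x (- s * 0)) + \<i> * of_real (s * pi))
          (at_right 0)"
    using x by (intro tendsto_intros tendsto_Ln tendsto_Complex)
      (auto simp: complex_nonpos_Reals_iff)
  moreover have "Ln (Complex x (- s * 0)) + \<i> * of_real (s * pi) = Complex (ln x) (s * pi)"
    using x Ln_of_real[of x] by (simp add: complex_of_real_def[symmetric] complex_eq_iff)
  moreover have "eventually (\<lambda>\<epsilon>. Ln (Complex x (- s * \<epsilon>)) + \<i> * of_real (s * pi)
                   = Ln (Complex (- x) (s * \<epsilon>))) (at_right 0)"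
    using eventually_at_right_less[of 0]
  proof eventually_elim
    case (elim \<epsilon>)
    have "Complex (- x) (s * \<epsilon>) = - Complex x (- s * \<epsilon>)" by (simp add: complex_eq_iff)
    moreover have "Complex x (- s * \<epsilon>) \<noteq> 0" using x by (simp add: complex_eq_iff)
    ultimately show ?case using Ln_minus[of "Complex x (- s * \<epsilon>)"] s x elim by auto
  qed
  ultimately show ?thesis by (auto elim: Lim_transform_eventually)
qed

definition cut_F :: "real \<Rightarrow> real \<Rightarrow> real" where
  "cut_F x a = ((ln x + Digamma a + 2 * euler_mascheroni) * kser a (- x) + kser_log a (- x))\<^sup>2
                + (pi * kser a (- x))\<^sup>2"

text \<open>The factor x comes from the square root of z, exp x from exp(-z/2) at z = -x, and
  \<open>Gamma\<close> cancels the \<open>rGamma\<close> of the logarithmic form. The sign s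
  survives only in the imaginary part s pi M, hence not in the modulus.\<close>

lemma norm_Gamma_whittaker_W_cut:
  fixes a x s :: real
  assumes a: "a > 0" and x: "x > 0" and s: "s = 1 \<or> s = -1"
  shows "(cmod (Gamma (of_real a) * whittaker_W_cut s (of_real (- a + 1 / 2)) 0 x))\<^sup>2
           = x * exp x * cut_F x a"
proof -
  let ?a = "complex_of_real a"
  let ?L = "Complex (ln x) (s * pi)"
  define U where "U = - rGamma ?a * ((?L + Digamma ?a + 2 * euler_mascheroni) * kser a (of_real (- x))
                       + kser_log a (of_real (- x)))"
  define W where "W = exp (- of_real (- x) / 2) * exp (1 / 2 * ?L) * U"
  have z: "((\<lambda>\<epsilon>. Complex (- x) (s * \<epsilon>)) \<longlongrightarrow> of_real (- x)) (at_right 0)"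
    using tendsto_Complex[of "\<lambda>_. - x" "- x" "at_right 0" "\<lambda>\<epsilon>. s * \<epsilon>" "s * 0"]
    by (simp add: complex_of_real_def tendsto_mult_right_zero)
  note L = tendsto_Ln_neg_cut[OF x s]
  have "((\<lambda>\<epsilon>. exp (- Complex (- x) (s * \<epsilon>) / 2) * exp (1 / 2 * Ln (Complex (- x) (s * \<epsilon>))) *
      (- rGamma ?a * ((Ln (Complex (- x) (s * \<epsilon>)) + Digamma ?a + 2 * euler_mascheroni)
          * kser a (Complex (- x) (s * \<epsilon>)) + kser_log a (Complex (- x) (s * \<epsilon>))))) \<longlongrightarrow> W) (at_right 0)"
    unfolding W_def U_def
    by (intro tendsto_intros z L isCont_tendsto_compose[OF isCont_kser[OF a] z]
        isCont_tendsto_compose[OF isCont_kser_log[OF a] z]) auto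
  moreover have "whittaker_W (of_real (- a + 1 / 2)) 0 (Complex (- x) (s * \<epsilon>)) =
      exp (- Complex (- x) (s * \<epsilon>) / 2) * exp (1 / 2 * Ln (Complex (- x) (s * \<epsilon>))) *
      (- rGamma ?a * ((Ln (Complex (- x) (s * \<epsilon>)) + Digamma ?a + 2 * euler_mascheroni)
          * kser a (Complex (- x) (s * \<epsilon>)) + kser_log a (Complex (- x) (s * \<epsilon>))))" for \<epsilon>
  proof -
    have nz: "Complex (- x) (s * \<epsilon>) \<noteq> 0" using x by (simp add: complex_eq_iff)
    then show ?thesis
      by (simp add: whittaker_W_def tricomi_U_log[OF a nz] powr_def)
  qed
  ultimately have "whittaker_W_cut s (of_real (- a + 1 / 2)) 0 x = W"
    unfolding whittaker_W_cut_def by (intro tendsto_Lim) auto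
  moreover have "cmod (Gamma ?a * W) ^ 2 = x * exp x * cut_F x a"
  proof -
    let ?V = "(?L + Digamma ?a + 2 * euler_mascheroni) * kser a (of_real (- x)) + kser_log a (of_real (- x))"
    have "Gamma ?a * rGamma ?a = 1"
      using Gamma_nonzero[OF complex_of_real_pos_notin_nonpos_Ints[OF a]]
      by (simp add: rGamma_inverse_Gamma)
    moreover have "Gamma ?a * U = - ((Gamma ?a * rGamma ?a) * ?V)"
      unfolding U_def by (simp only: mult.assoc mult_minus_left mult_minus_right)
    ultimately have "Gamma ?a * U = - ?V" by simp
    then have "cmod (Gamma ?a * W) = cmod (exp (- of_real (- x) / 2)) * cmod (exp (1 / 2 * ?L)) * cmod ?V"
      unfolding W_def mult.left_commute[of "Gamma ?a"] norm_mult[of _ "Gamma ?a * U"]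
      by (simp only: norm_mult norm_minus_cancel)
    moreover have "cmod (exp (- of_real (- x) / 2)) ^ 2 = exp x"
      by (simp add: exp_double[symmetric])
    moreover have "cmod (exp (1 / 2 * ?L)) ^ 2 = x"
      using x by (simp add: exp_double[symmetric])
    moreover have "cmod ?V ^ 2 = cut_F x a"
    proof -
      have "(euler_mascheroni :: complex) = of_real euler_mascheroni" by simp
      then have "Re euler_mascheroni = euler_mascheroni" "Im euler_mascheroni = 0"
        by (metis Re_complex_of_real, metis Im_complex_of_real)
      then have "?V = Complex ((ln x + Digamma a + 2 * euler_mascheroni) * kser a (- x) + kser_log a (- x))
                   (s * pi * kser a (- x))"
        unfolding kser_of_real[OF a] kser_log_of_real[OF a]
        using a by (simp add: complex_eq_iff Polygamma_of_real)
      then show ?thesis using s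
        by (auto simp: cmod_power2 cut_F_def)
    qed
    ultimately show ?thesis by (simp add: power_mult_distrib)
  qed
  ultimately show ?thesis by simp
qed

section \<open>The density near the origin\<close>

lemma DERIV_inverse_scaled:
  fixes f :: "real \<Rightarrow> real"
  assumes "(f has_real_derivative f') (at a)" "f a = F" "c \<noteq> 0" "F \<noteq> 0"
  shows "((\<lambda>a. 1 / (c * f a)) has_real_derivative - f' / (c * F\<^sup>2)) (at a)"
  using assms by (auto intro!: derivative_eq_intros simp: power2_eq_square)

text \<open>Here P is dF/da, l is ln x, e is exp x and T is psi'(a). The left side is built from P /
  l and F / l^2, which have the finite limits 2 T and 1 as x tends to 0.\<close>

lemma density_ratio_identity:
  fixes P x e F T l :: real
  assumes "x \<noteq> 0" "l \<noteq> 0"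
  shows "(P / l) / (2 * T * e * (F / l\<^sup>2)\<^sup>2) = (- P / (x * e * F\<^sup>2)) / (2 / x * (T / (- l) ^ 3))"
proof -
  have "(- P / (x * e * F\<^sup>2)) / (2 / x * (T / (- l) ^ 3)) = P * l ^ 3 / (2 * T * e * F\<^sup>2)"
    using assms(1) by (simp add: power3_eq_cube mult_ac)
  also have "\<dots> = (P / l) / (2 * T * e * (F / l\<^sup>2)\<^sup>2)"
    using assms(2) by (simp add: power_divide power3_eq_cube power2_eq_square mult_ac)
  finally show ?thesis by simp
qed

lemma antisym_sq_density_asymp:
  fixes \<alpha> s :: real
  assumes \<alpha>: "\<alpha> > 0" and s: "s = 1 \<or> s = -1"
  shows "antisym_sq_density s \<alpha> \<sim>[at_right 0]
           (\<lambda>x. 2 / x * (Polygamma 1 \<alpha> / \<bar>ln x\<bar> ^ 3))"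
proof (rule asymp_equivI')
  define c where "c = Digamma \<alpha> + 2 * euler_mascheroni"
  define T where "T = Polygamma 1 \<alpha>"
  have aZ: "\<alpha> \<notin> \<int>\<^sub>\<le>\<^sub>0" using \<alpha> by (auto elim!: nonpos_Ints_cases)
  have T: "T > 0" unfolding T_def using aZ by (intro Polygamma_real_odd_pos) auto
  obtain k' Dk where k': "\<And>y. ((\<lambda>b. kser b y) has_real_derivative k' y) (at \<alpha>)"
    "(k' has_real_derivative Dk) (at 0)" "k' 0 = 0"
    using kser_has_derivative_param[OF \<alpha>] by metis
  obtain r' Dr where r': "\<And>y. ((\<lambda>b. kser_log b y) has_real_derivative r' y) (at \<alpha>)"
    "(r' has_real_derivative Dr) (at 0)" "r' 0 = 0"
    using kser_log_has_derivative_param[OF \<alpha>] by metis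
  define K where "K = (\<lambda>x. kser \<alpha> (- x) :: real)"
  define R where "R = (\<lambda>x. kser_log \<alpha> (- x) :: real)"
  define k where "k = (\<lambda>x. k' (- x))"
  define r where "r = (\<lambda>x. r' (- x))"
  define F' where "F' = (\<lambda>x. 2 * ((ln x + c) * K x + R x) * ((ln x + c) * k x + T * K x + r x)
                          + 2 * pi\<^sup>2 * K x * k x)"
  have neg: "((\<lambda>x::real. - x) \<longlongrightarrow> 0) (at_right 0)"
    by (auto intro!: tendsto_eq_intros)
  have K: "(K \<longlongrightarrow> 1) (at_right 0)"
    unfolding K_def using isCont_tendsto_compose[OF isCont_kser[OF \<alpha>] neg] by (simp add: kser_0)
  have R: "(R \<longlongrightarrow> 0) (at_right 0)"
    unfolding R_def using isCont_tendsto_compose[OF isCont_kser_log[OF \<alpha>] neg] by (simp add: kser_log_0)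
  have k: "(k \<longlongrightarrow> 0) (at_right 0)"
    unfolding k_def using isCont_tendsto_compose[OF DERIV_isCont[OF k'(2)] neg] k'(3) by simp
  have r: "(r \<longlongrightarrow> 0) (at_right 0)"
    unfolding r_def using isCont_tendsto_compose[OF DERIV_isCont[OF r'(2)] neg] r'(3) by simp
  have il: "((\<lambda>x::real. 1 / ln x) \<longlongrightarrow> 0) (at_right 0)" by real_asymp
  \<comment> \<open>The difference quotient of k' at 0 tends to Dk, while x ln x tends to 0.\<close>
  have lk: "((\<lambda>x. ln x * k x) \<longlongrightarrow> 0) (at_right 0)"
  proof -
    have "((\<lambda>y. k' y / y) \<longlongrightarrow> Dk) (at 0)"
      using k'(2,3) by (simp add: has_field_derivative_iff)
    moreover have "filterlim (\<lambda>x::real. - x) (at 0) (at_right 0)"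
      by (rule filterlim_atI[OF neg]) (auto simp: eventually_at_filter)
    ultimately have "((\<lambda>x. k' (- x) / (- x)) \<longlongrightarrow> Dk) (at_right 0)"
      by (rule filterlim_compose)
    moreover have "((\<lambda>x::real. - x * ln x) \<longlongrightarrow> 0) (at_right 0)" by real_asymp
    ultimately have "((\<lambda>x. k' (- x) / (- x) * (- x * ln x)) \<longlongrightarrow> Dk * 0) (at_right 0)"
      by (rule tendsto_mult)
    moreover have "eventually (\<lambda>x. k' (- x) / (- x) * (- x * ln x) = ln x * k x) (at_right 0)"
      using eventually_at_right_less[of "0::real"] by eventually_elim (simp add: k_def)
    ultimately show ?thesis by (auto elim: Lim_transform_eventually)
  qed
  \<comment> \<open>The real part inside \<open>cut_F\<close>, divided by ln x.\<close>
  define A where "A = (\<lambda>x. (1 + c * (1 / ln x)) * K x + R x * (1 / ln x))"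
  have A: "(A \<longlongrightarrow> 1) (at_right 0)"
    unfolding A_def by (rule tendsto_eq_intros il K R refl)+ simp
  \<comment> \<open>The limit is left with every ingredient replaced by its own limit; its value is
    2 T / (2 T) = 1.\<close>
  have lim: "((\<lambda>x. (2 * A x * (ln x * k x + c * k x + T * K x + r x) + 2 * pi\<^sup>2 * K x * k x * (1 / ln x))
      / (2 * T * exp x * ((A x)\<^sup>2 + (pi * K x * (1 / ln x))\<^sup>2)\<^sup>2)) \<longlongrightarrow>
      (2 * 1 * (0 + c * 0 + T * 1 + 0) + 2 * pi\<^sup>2 * 1 * 0 * 0)
        / (2 * T * exp 0 * (1\<^sup>2 + (pi * 1 * 0)\<^sup>2)\<^sup>2)) (at_right 0)"
    by (intro tendsto_intros il K R k r lk A) (use T in auto)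
  \<comment> \<open>Positivity of K makes F positive through the term (pi K)^2, and x < 1 fixes the
    sign of ln x.\<close>
  have "eventually (\<lambda>x. K x > 0) (at_right 0)"
    using order_tendstoD(1)[OF K, of 0] by simp
  moreover have "eventually (\<lambda>x::real. x \<in> {0<..<1}) (at_right 0)"
    by (rule eventually_at_right_real) simp
  ultimately have "eventually (\<lambda>x. (2 * A x * (ln x * k x + c * k x + T * K x + r x)
        + 2 * pi\<^sup>2 * K x * k x * (1 / ln x))
      / (2 * T * exp x * ((A x)\<^sup>2 + (pi * K x * (1 / ln x))\<^sup>2)\<^sup>2)
      = antisym_sq_density s \<alpha> x / (2 / x * (Polygamma 1 \<alpha> / \<bar>ln x\<bar> ^ 3))) (at_right 0)"
  proof eventually_elim
    case (elim x)
    then have x: "x > 0" "x < 1" and l: "ln x < 0" and K0: "K x > 0" by auto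
    define F where "F = cut_F x \<alpha>"
    have F: "F > 0" unfolding F_def cut_F_def using K0 by (intro add_nonneg_pos) (auto simp: K_def)
    have "((\<lambda>a. cut_F x a) has_real_derivative F' x) (at \<alpha>)"
      unfolding cut_F_def F'_def
      by (rule derivative_eq_intros k' r' refl aZ)+
         (simp add: K_def R_def k_def r_def c_def T_def algebra_simps power2_eq_square)
    then have "((\<lambda>a. 1 / (x * exp x * cut_F x a)) has_real_derivative
                  - F' x / (x * exp x * F\<^sup>2)) (at \<alpha>)"
      by (rule DERIV_inverse_scaled) (use F x in \<open>auto simp: F_def\<close>)
    then have "deriv (\<lambda>a. 1 / (x * exp x * cut_F x a)) \<alpha> = - F' x / (x * exp x * F\<^sup>2)"
      by (rule DERIV_imp_deriv)
    \<comment> \<open>The closed form of the modulus is available only for a > 0, so the two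
      functions of a are compared near \<open>\<alpha>\<close> before differentiating.\<close>
    moreover have "eventually (\<lambda>a. a > 0) (nhds \<alpha>)"
      using eventually_nhds_in_open[of "{0<..}" \<alpha>] \<alpha> by simp
    then have "eventually (\<lambda>a. 1 / (cmod (Gamma (complex_of_real a)
                   * whittaker_W_cut s (complex_of_real (- a + 1 / 2)) 0 x))\<^sup>2
                 = 1 / (x * exp x * cut_F x a)) (nhds \<alpha>)"
      by eventually_elim (simp only: norm_Gamma_whittaker_W_cut x s)
    ultimately have d: "antisym_sq_density s \<alpha> x = - F' x / (x * exp x * F\<^sup>2)"
      unfolding antisym_sq_density_def by (subst deriv_cong_ev[OF _ refl]) auto
    define l where "l = ln x"
    have l0: "l < 0" using l by (simp add: l_def)
    have "(A x)\<^sup>2 + (pi * K x * (1 / ln x))\<^sup>2 = F / l\<^sup>2"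
    proof -
      have "F = ((l + c) * K x + R x)\<^sup>2 + (pi * K x)\<^sup>2"
        by (simp add: F_def cut_F_def K_def R_def c_def l_def add_ac)
      moreover have "(l + c) * K x + R x = l * A x"
        using l0 by (simp add: A_def l_def[symmetric] distrib_left distrib_right)
      ultimately show ?thesis using l0
        by (simp add: l_def[symmetric] add_divide_distrib power_mult_distrib power_divide)
    qed
    moreover have "2 * A x * (ln x * k x + c * k x + T * K x + r x)
        + 2 * pi\<^sup>2 * K x * k x * (1 / ln x) = F' x / l"
    proof -
      have "(l + c) * K x + R x = l * A x"
        using l0 by (simp add: A_def l_def[symmetric] distrib_left distrib_right)
      then have "F' x = 2 * (l * A x) * ((l + c) * k x + T * K x + r x) + 2 * pi\<^sup>2 * K x * k x"
        by (simp only: F'_def l_def)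
      then show ?thesis using l0
        by (simp add: l_def[symmetric] add_divide_distrib distrib_right)
    qed
    moreover have "\<bar>ln x\<bar> = - l" using l0 by (simp add: l_def)
    ultimately show ?case
      unfolding d T_def[symmetric] using x l0
      by (simp only: density_ratio_identity less_imp_neq[symmetric] less_imp_neq not_False_eq_True)
  qed
  from Lim_transform_eventually[OF lim this] T
  show "((\<lambda>x. antisym_sq_density s \<alpha> x / (2 / x * (Polygamma 1 \<alpha> / \<bar>ln x\<bar> ^ 3))) \<longlongrightarrow> 1) (at_right 0)"
    by simp
qed

theorem mainTheorem10:
  fixes \<alpha> s :: real
  assumes "\<alpha> > 0" and "s = 1 \<or> s = -1"
  shows "antisym_sq_density s \<alpha> \<sim>[at_right 0]
           (\<lambda>x. 2 / x * (deriv Digamma \<alpha> / \<bar>ln x\<bar> ^ 3))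
         \<and> (\<lambda>n. 1 / (\<alpha> + real n)\<^sup>2) sums deriv Digamma \<alpha>"
proof -
  have aZ: "\<alpha> \<notin> \<int>\<^sub>\<le>\<^sub>0" using assms(1) by (auto elim!: nonpos_Ints_cases)
  have deriv: "deriv Digamma \<alpha> = Polygamma 1 \<alpha>"
    using DERIV_imp_deriv[OF has_field_derivative_Polygamma[OF aZ, of 0 UNIV]] by simp
  have "(\<lambda>n. 1 / (\<alpha> + real n)\<^sup>2) sums Polygamma 1 \<alpha>"
    using Polygamma_LIMSEQ[of \<alpha> 1] assms(1)
    by (simp add: field_simps power2_eq_square numeral_2_eq_2)
  then show ?thesis
    unfolding deriv using antisym_sq_density_asymp[OF assms] by blast
qed

end
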